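(* If $r\ge2$ is an even integer, then the hereditary $\mathcal L_r$-property $\mathcal P=\mathcal M_r$ of finite metric spaces with all distances in $\{1,\dots,r\}$ has a stability theorem.
   Context: For an integer $r\ge2$ let $\mathcal L_r=\{R_1(x,y),\dots,R_r(x,y)\}$ consist of $r$ binary relation symbols. A metric space with underlying set $V$ and all distances (between distinct points) in $[r]=\{1,\dots,r\}$ is viewed as an $\mathcal L_r$-structure with domain $V$ by: $R_i(x,y)$ holds iff $d(x,y)=i$. $\mathcal M_r$ is the class of $\mathcal L_r$-structures isomorphic to such a space with underlying set $[n]$ for some $n$; it is closed under isomorphism and substructures. Write $\mathcal P=\mathcal M_r$ and $\mathcal L=\mathcal L_r$ (maximum arity $2$; $r$ denotes only the largest distance). All types are quantifier-free. $\binom V2$ is the set of 2-element subsets of $V$. $S_2(\mathcal P)$ is the set of complete quantifier-free 2-types $p(x_1,x_2)$ containing $x_1\ne x_2$ and realized in some element of $\mathcal P$ (these are the types $p_i$, $i\in[r]$, saying that the distance between $x_1$ and $x_2$ is $i$). For a set $V$, $C_V=\{c_v:v\in V\}$ are new constants, and $S_2(C_V,\mathcal P)=\{p(c_u,c_v):p\in S_2(\mathcal P),u\ne v\in V\}$, where $p(c_u,c_v)$ is the set of sentences obtained by substitution. For an $\mathcal L$-structure $N$ and $A\subseteq\mathrm{dom}(N)$, $Diag^N(A)$ is the set of quantifier-free sentences in $\mathcal L\cup C_A$ true in $N$ when $c_a$ names $a$. $\mathcal L_{\mathcal P}=\{R_p:p\in S_2(\mathcal P)\}$, each $R_p$ binary.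 An $\mathcal L_{\mathcal P}$-structure $M$ with domain $V$ is complete if for all $uv\in\binom V2$ some $R_p$ holds of $(u,v)$ or of $(v,u)$. It is an $\mathcal L_{\mathcal P}$-template if it is complete, no $R_p(u,u)$ holds, and whenever $p,p'\in S_2(\mathcal P)$ and a permutation $\mu$ of $\{1,2\}$ satisfy $p(\bar x)=p'(\mu(\bar x))$, then for all pairs $\bar a$ of distinct elements of $V$, $M\models R_p(\bar a)$ iff $M\models R_{p'}(\mu(\bar a))$, where $\mu(a_1,a_2)=(a_{\mu(1)},a_{\mu(2)})$. For $A\in\binom V2$, $Ch_M(A)=\{p(c_a,c_b)\in S_2(C_V,\mathcal P):\{a,b\}=A,\ M\models R_p(a,b)\}$. A choice function for $M$ is $\chi:\binom V2\to S_2(C_V,\mathcal P)$ with $\chi(A)\in Ch_M(A)$ for all $A$. For complete $M$, an $\mathcal L$-structure $N$ with domain $V$ is a full subpattern chosen by $\chi$, $N\unlhd_\chi M$, if $Diag^N(A)=\chi(A)$ for all $A\in\binom V2$; $N\unlhd_pM$ means $N\unlhd_\chi M$ for some $\chi$. $sub(M)=|\{N:N\unlhd_pM\}|$. $M$ is $\mathcal P$-random if it is complete and for every choice function $\chi$ there is $N\in\mathcal P$ with $N\unlhd_\chi M$. $\mathcal R(n,\mathcal P)$ is the class of $\mathcal P$-random $\mathcal L_{\mathcal P}$-templates with domain of size $n$; $ex(n,\mathcal P)=\max\{sub(M):M\in\mathcal R(n,\mathcal P)\}$; $\mathcal R_{ex}(n,\mathcal P)$ is the class of $M\in\mathcal R(n,\mathcal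 P)$ with $sub(M)=ex(n,\mathcal P)$. Two $\mathcal L_{\mathcal P}$-structures $M,M'$ with the same domain $V$ of size $n$ are $\delta$-close if the number of $A\in\binom V2$ such that for some enumeration $\bar a$ of $A$ the quantifier-free types of $\bar a$ in $M$ and in $M'$ differ is at most $\delta\binom n2$. $\mathcal P$ has a stability theorem if for all $\delta>0$ there are $\epsilon>0$ and $N$ such that for all $n>N$: if $M\in\mathcal R(n,\mathcal P)$ satisfies $sub(M)\ge ex(n,\mathcal P)^{1-\epsilon}$, then $M$ is $\delta$-close to some $M'\in\mathcal R_{ex}(n,\mathcal P)$ (with the same domain). *)

theory Defs
  imports "HOL-Analysis.Abstract_Metric_Spaces" "HOL-Combinatorics.Permutations"
begin

text \<open>
  A binary relational language is given by its set \<open>L\<close> of symbols. Structures live in an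
  arbitrary type of points. A relation symbol outside \<open>L\<close> is interpreted by the empty relation
  and relations are confined to the universe, so that two \<open>L\<close>-structures are equal in HOL
  iff they have the same universe and the same interpretation of every symbol in \<open>L\<close>; this
  matters when structures are counted. A class \<open>P\<close> of structures is given by its members with
  points in \<open>'v\<close>; if \<open>'v\<close> is infinite, these include a copy of every finite member.
\<close>

record ('s, 'v) rstruct =
  univ :: "'v set"
  rel :: "'s \<Rightarrow> ('v \<times> 'v) set"

definition is_structure :: "'s set \<Rightarrow> ('s, 'v) rstruct \<Rightarrow> bool" where
  "is_structure L N \<longleftrightarrow>
     (\<forall>s\<in>L. rel N s \<subseteq> univ N \<times> univ N) \<and> (\<forall>s. s \<notin> L \<longrightarrow> rel N s = {})"

definition isomorphic :: "'s set \<Rightarrow> ('s, 'v) rstruct \<Rightarrow> ('s, 'w) rstruct \<Rightarrow> bool" where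
  "isomorphic L N N' \<longleftrightarrow>
     (\<exists>f. bij_betw f (univ N) (univ N') \<and>
        (\<forall>s\<in>L. \<forall>x\<in>univ N. \<forall>y\<in>univ N. (x, y) \<in> rel N s \<longleftrightarrow> (f x, f y) \<in> rel N' s))"

definition pairs :: "'v set \<Rightarrow> 'v set set" where
  "pairs V = {A. A \<subseteq> V \<and> card A = 2}"


text \<open>
  Quantifier-free formulas. The parameter \<open>'t\<close> is the type of terms: \<open>nat\<close> for formulas in the
  variables \<open>x\<^sub>1\<close>, \<open>x\<^sub>2\<close> (written as the indices \<open>1\<close>, \<open>2\<close>), and the type of points \<open>'v\<close> for
  sentences in constants \<open>c\<^sub>v\<close> (written as \<open>v\<close>). Substitution of terms is \<open>map_qf id\<close>.
\<close>

datatype (syms: 's, trms: 't) qf =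
    Rel 's 't 't
  | Equal 't 't
  | Neg "('s, 't) qf"
  | Conj "('s, 't) qf" "('s, 't) qf"
  | Disj "('s, 't) qf" "('s, 't) qf"

primrec sat :: "('s, 'v) rstruct \<Rightarrow> ('t \<Rightarrow> 'v) \<Rightarrow> ('s, 't) qf \<Rightarrow> bool" where
  "sat N a (Rel s t u) \<longleftrightarrow> (a t, a u) \<in> rel N s"
| "sat N a (Equal t u) \<longleftrightarrow> a t = a u"
| "sat N a (Neg \<phi>) \<longleftrightarrow> \<not> sat N a \<phi>"
| "sat N a (Conj \<phi> \<psi>) \<longleftrightarrow> sat N a \<phi> \<and> sat N a \<psi>"
| "sat N a (Disj \<phi> \<psi>) \<longleftrightarrow> sat N a \<phi> \<or> sat N a \<psi>"

definition formulas :: "'s set \<Rightarrow> 't set \<Rightarrow> ('s, 't) qf set" where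
  "formulas L T = {\<phi>. syms \<phi> \<subseteq> L \<and> trms \<phi> \<subseteq> T}"

text \<open>A pair \<open>(a\<^sub>1, a\<^sub>2)\<close> as an assignment to the variables; only the values at \<open>1\<close>, \<open>2\<close> matter.\<close>

definition tup :: "'v \<Rightarrow> 'v \<Rightarrow> nat \<Rightarrow> 'v" where
  "tup a b i = (if i = 1 then a else b)"

definition qftp :: "'s set \<Rightarrow> ('s, 'v) rstruct \<Rightarrow> 'v \<Rightarrow> 'v \<Rightarrow> ('s, nat) qf set" where
  "qftp L N a b = {\<phi> \<in> formulas L {1, 2}. sat N (tup a b) \<phi>}"

definition diag :: "'s set \<Rightarrow> ('s, 'v) rstruct \<Rightarrow> 'v set \<Rightarrow> ('s, 'v) qf set" where
  "diag L N A = {\<phi> \<in> formulas L A. sat N id \<phi>}"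

definition inst :: "('s, nat) qf set \<Rightarrow> 'v \<Rightarrow> 'v \<Rightarrow> ('s, 'v) qf set" where
  "inst p u v = map_qf id (tup u v) ` p"

text \<open>\<open>S2 L P\<close> is \<open>S\<^sub>2(P)\<close> and \<open>S2C L P V\<close> is \<open>S\<^sub>2(C\<^sub>V, P)\<close>.\<close>

definition S2 :: "'s set \<Rightarrow> ('s, 'v) rstruct set \<Rightarrow> ('s, nat) qf set set" where
  "S2 L P = {p. p \<subseteq> formulas L {1, 2} \<and>
                (\<forall>\<phi> \<in> formulas L {1, 2}. \<phi> \<in> p \<or> Neg \<phi> \<in> p) \<and>
                Neg (Equal 1 2) \<in> p \<and>
                (\<exists>N\<in>P. \<exists>a\<in>univ N. \<exists>b\<in>univ N. \<forall>\<phi>\<in>p. sat N (tup a b) \<phi>)}"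

definition S2C :: "'s set \<Rightarrow> ('s, 'v) rstruct set \<Rightarrow> 'v set \<Rightarrow> ('s, 'v) qf set set" where
  "S2C L P V = {inst p u v | p u v. p \<in> S2 L P \<and> u \<in> V \<and> v \<in> V \<and> u \<noteq> v}"


text \<open>The symbol \<open>R\<^sub>p\<close> of the language associated with \<open>P\<close> is the type \<open>p \<in> S2 L P\<close> itself.\<close>

type_synonym ('s, 'v) pstruct = "(('s, nat) qf set, 'v) rstruct"

definition complete_structure ::
    "'s set \<Rightarrow> ('s, 'v) rstruct set \<Rightarrow> ('s, 'v) pstruct \<Rightarrow> bool" where
  "complete_structure L P M \<longleftrightarrow>
     is_structure (S2 L P) M \<and>
     (\<forall>u\<in>univ M. \<forall>v\<in>univ M. u \<noteq> v \<longrightarrow>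
        (\<exists>p\<in>S2 L P. (u, v) \<in> rel M p \<or> (v, u) \<in> rel M p))"

definition template ::
    "'s set \<Rightarrow> ('s, 'v) rstruct set \<Rightarrow> ('s, 'v) pstruct \<Rightarrow> bool" where
  "template L P M \<longleftrightarrow>
     complete_structure L P M \<and>
     (\<forall>p\<in>S2 L P. \<forall>u\<in>univ M. (u, u) \<notin> rel M p) \<and>
     (\<forall>p\<in>S2 L P. \<forall>p'\<in>S2 L P. \<forall>\<mu>. \<mu> permutes {1, 2} \<longrightarrow> p = map_qf id \<mu> ` p' \<longrightarrow>
        (\<forall>a::nat \<Rightarrow> 'v. a 1 \<in> univ M \<longrightarrow> a 2 \<in> univ M \<longrightarrow> a 1 \<noteq> a 2 \<longrightarrow>
           ((a 1, a 2) \<in> rel M p \<longleftrightarrow> (a (\<mu> 1), a (\<mu> 2)) \<in> rel M p')))"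

definition Ch ::
    "'s set \<Rightarrow> ('s, 'v) rstruct set \<Rightarrow> ('s, 'v) pstruct \<Rightarrow> 'v set \<Rightarrow> ('s, 'v) qf set set" where
  "Ch L P M A = {inst p a b | p a b. p \<in> S2 L P \<and> inst p a b \<in> S2C L P (univ M) \<and>
                                     {a, b} = A \<and> (a, b) \<in> rel M p}"

definition choice_function ::
    "'s set \<Rightarrow> ('s, 'v) rstruct set \<Rightarrow> ('s, 'v) pstruct \<Rightarrow> ('v set \<Rightarrow> ('s, 'v) qf set) \<Rightarrow> bool" where
  "choice_function L P M \<xi> \<longleftrightarrow> (\<forall>A\<in>pairs (univ M). \<xi> A \<in> Ch L P M A)"

definition full_subpattern_by ::
    "'s set \<Rightarrow> ('s, 'v) rstruct set \<Rightarrow> ('v set \<Rightarrow> ('s, 'v) qf set) \<Rightarrow>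
     ('s, 'v) rstruct \<Rightarrow> ('s, 'v) pstruct \<Rightarrow> bool" where
  "full_subpattern_by L P \<xi> N M \<longleftrightarrow>
     choice_function L P M \<xi> \<and> is_structure L N \<and> univ N = univ M \<and>
     (\<forall>A\<in>pairs (univ M). diag L N A = \<xi> A)"

definition full_subpattern ::
    "'s set \<Rightarrow> ('s, 'v) rstruct set \<Rightarrow> ('s, 'v) rstruct \<Rightarrow> ('s, 'v) pstruct \<Rightarrow> bool" where
  "full_subpattern L P N M \<longleftrightarrow> (\<exists>\<xi>. full_subpattern_by L P \<xi> N M)"

definition sub :: "'s set \<Rightarrow> ('s, 'v) rstruct set \<Rightarrow> ('s, 'v) pstruct \<Rightarrow> nat" where
  "sub L P M = card {N. full_subpattern L P N M}"

definition random_structure ::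
    "'s set \<Rightarrow> ('s, 'v) rstruct set \<Rightarrow> ('s, 'v) pstruct \<Rightarrow> bool" where
  "random_structure L P M \<longleftrightarrow>
     complete_structure L P M \<and>
     (\<forall>\<xi>. choice_function L P M \<xi> \<longrightarrow> (\<exists>N\<in>P. full_subpattern_by L P \<xi> N M))"

definition random_templates ::
    "'s set \<Rightarrow> ('s, 'v) rstruct set \<Rightarrow> nat \<Rightarrow> ('s, 'v) pstruct set" where
  "random_templates L P n =
     {M. template L P M \<and> random_structure L P M \<and> finite (univ M) \<and> card (univ M) = n}"

definition ex_num :: "'s set \<Rightarrow> ('s, 'v) rstruct set \<Rightarrow> nat \<Rightarrow> nat" where
  "ex_num L P n = Max (sub L P ` random_templates L P n)"

definition extremal_templates ::
    "'s set \<Rightarrow> ('s, 'v) rstruct set \<Rightarrow> nat \<Rightarrow> ('s, 'v) pstruct set" where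
  "extremal_templates L P n = {M \<in> random_templates L P n. sub L P M = ex_num L P n}"

definition delta_close ::
    "'s set \<Rightarrow> ('s, 'v) rstruct set \<Rightarrow> real \<Rightarrow> ('s, 'v) pstruct \<Rightarrow> ('s, 'v) pstruct \<Rightarrow> bool" where
  "delta_close L P \<delta> M M' \<longleftrightarrow>
     univ M = univ M' \<and>
     real (card {A \<in> pairs (univ M).
                   \<exists>a b. {a, b} = A \<and> qftp (S2 L P) M a b \<noteq> qftp (S2 L P) M' a b})
       \<le> \<delta> * real (card (univ M) choose 2)"

definition has_stability_theorem :: "'s set \<Rightarrow> ('s, 'v) rstruct set \<Rightarrow> bool" where
  "has_stability_theorem L P \<longleftrightarrow>
     (\<forall>\<delta>>0. \<exists>\<epsilon>>0. \<exists>N. \<forall>n>N. \<forall>M\<in>random_templates L P n.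
        real (sub L P M) \<ge> real (ex_num L P n) powr (1 - \<epsilon>) \<longrightarrow>
        (\<exists>M'\<in>extremal_templates L P n. delta_close L P \<delta> M M'))"


definition metric_structure ::
    "nat \<Rightarrow> 'v set \<Rightarrow> ('v \<Rightarrow> 'v \<Rightarrow> real) \<Rightarrow> (nat, 'v) rstruct" where
  "metric_structure r V d =
     \<lparr>univ = V,
      rel = (\<lambda>i. if i \<in> {1..r} then {(x, y). x \<in> V \<and> y \<in> V \<and> d x y = real i} else {})\<rparr>"

text \<open>The class \<open>M\<^sub>r\<close>, restricted to structures whose points have type \<open>'v\<close>; its language is \<open>{1..r}\<close>.\<close>

definition metric_class :: "nat \<Rightarrow> (nat, 'v) rstruct set" where
  "metric_class r =
     {N. is_structure {1..r} N \<and>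
         (\<exists>(n::nat) d. Metric_space {1..n} d \<and>
            (\<forall>x\<in>{1..n}. \<forall>y\<in>{1..n}. x \<noteq> y \<longrightarrow> d x y \<in> real ` {1..r}) \<and>
            isomorphic {1..r} N (metric_structure r {1..n} d))}"

end

theory Submission
  imports Defs
begin

text \<open>
  A quantifier-free type of a pair of distinct points of a metric space is determined by their
  distance, so a template on \<open>V\<close> assigns to every pair \<open>A\<close> of points a nonempty set \<open>c A\<close> of
  possible distances (a palette; lemma \<open>template_imp_palette_template\<close>). Its full subpatterns
  are the structures obtained by choosing a distance from \<open>c A\<close> for each \<open>A\<close>, so there are
  \<open>\<Prod>A. card (c A)\<close> of them, and the template is random iff in every triangle every choice of
  three distances satisfies the triangle inequality.

  Let \<open>r = 2h\<close>. If a triangle carries the sets \<open>c\<^sub>1, c\<^sub>2, c\<^sub>3\<close>, then \<open>max c\<^sub>1 \<le> min c\<^sub>2 + min c\<^sub>3\<close> and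
  its cyclic variants hold, and all maxima are at most \<open>2h\<close>. Adding these bounds to
  \<open>card c\<^sub>i \<le> max c\<^sub>i - min c\<^sub>i + 1\<close> gives \<open>card c\<^sub>1 + card c\<^sub>2 + card c\<^sub>3 \<le> 3(h + 1)\<close>, hence by the
  inequality of arithmetic and geometric means the product of the three sizes is at most
  \<open>(h + 1)\<^sup>3\<close>, with equality only if all three sets are \<open>{h..2h}\<close>. Products are integers, so in
  every other triangle the sum of the logarithms of the sizes falls short of \<open>3 ln (h + 1)\<close> by a
  constant \<open>\<kappa> > 0\<close>. Such a triangle has at most three pairs with \<open>c A \<noteq> {h..2h}\<close>, so one can
  charge \<open>\<kappa>/3\<close> to each of these pairs, and averaging over all triangles yields
  (lemma \<open>sum_ln_card_palette_le\<close>)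

    \<open>ln (sub M) \<le> (n choose 2) ln (h + 1) - (\<kappa>/3) B\<close>,

  where \<open>B\<close> is the number of pairs with \<open>c A \<noteq> {h..2h}\<close>. The constant palette \<open>{h..2h}\<close> is random
  because \<open>2h \<le> h + h\<close>; so it is extremal for \<open>n \<ge> 3\<close>, with \<open>(h + 1)\<close> to the power
  \<open>n choose 2\<close> subpatterns. If \<open>ln (sub M)\<close> is at least \<open>1 - \<epsilon>\<close> times the logarithm of that number,
  then \<open>B \<le> (3 \<epsilon> ln (h + 1) / \<kappa>) (n choose 2)\<close>, which is stability.
\<close>

(* The variables of a type are the numerals 1 and 2, and distances lie in {1..r}: rewriting 1 to
   Suc 0 would keep facts about {1, 2} and {1..r} from matching. *)
declare One_nat_def [simp del]

section \<open>Types of pairs in a metric space\<close>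

lemma pairsE:
  assumes "A \<in> pairs V"
  obtains u v where "A = {u, v}" "u \<noteq> v" "u \<in> V" "v \<in> V"
  using assms by (auto simp: pairs_def card_2_iff)

lemma pairsI: "u \<in> V \<Longrightarrow> v \<in> V \<Longrightarrow> u \<noteq> v \<Longrightarrow> {u, v} \<in> pairs V"
  by (auto simp: pairs_def)

lemma finite_pairs: "finite V \<Longrightarrow> finite (pairs V)"
  by (rule finite_subset[of _ "Pow V"]) (auto simp: pairs_def)

text \<open>
  Quantifier-free truth depends only on the atomic facts about the named points, so the
  assignments and structures may live over different types of points.
\<close>

lemma sat_cong:
  assumes "\<phi> \<in> formulas L T"
    and "\<And>s t u. s \<in> L \<Longrightarrow> t \<in> T \<Longrightarrow> u \<in> T \<Longrightarrow> (a t, a u) \<in> rel N s \<longleftrightarrow> (a' t, a' u) \<in> rel N' s"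
    and "\<And>t u. t \<in> T \<Longrightarrow> u \<in> T \<Longrightarrow> a t = a u \<longleftrightarrow> a' t = a' u"
  shows "sat N a \<phi> \<longleftrightarrow> sat N' a' \<phi>"
  using assms(1) by (induction \<phi>) (auto simp: formulas_def assms(2,3))

lemma sat_map: "sat N a (map_qf id h \<phi>) \<longleftrightarrow> sat N (a \<circ> h) \<phi>"
  by (induction \<phi>) auto

lemma tup_simps [simp]: "tup a b (Suc 0) = a" "tup a b 1 = a" "tup a b 2 = b"
  by (auto simp: tup_def)

text \<open>
  Since \<open>u \<noteq> v\<close>, substituting the constants \<open>u\<close>, \<open>v\<close> for the two variables is a bijection on
  formulas. Thus the sentences chosen by a template can be compared with diagrams.
\<close>

lemma inst_qftp:
  assumes "u \<noteq> v"
  shows "inst (qftp L N u v) u v = diag L N {u, v}"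
proof (intro equalityI subsetI)
  fix \<phi> assume "\<phi> \<in> inst (qftp L N u v) u v"
  then show "\<phi> \<in> diag L N {u, v}"
    by (fastforce simp: inst_def qftp_def diag_def formulas_def sat_map qf.set_map tup_def
        split: if_splits)
next
  fix \<phi> assume \<phi>: "\<phi> \<in> diag L N {u, v}"
  define k where "k x = (if x = u then 1 else 2 :: nat)" for x
  define \<psi> where "\<psi> = map_qf id k \<phi>"
  have t: "trms \<phi> \<subseteq> {u, v}" using \<phi> by (auto simp: diag_def formulas_def)
  have eq: "map_qf id (tup u v) \<psi> = \<phi>"
  proof -
    have "map_qf id (tup u v) \<psi> = map_qf (id \<circ> id) (tup u v \<circ> k) \<phi>"
      unfolding \<psi>_def by (simp add: qf.map_comp)
    also have "\<dots> = map_qf id id \<phi>"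
      using t by (intro qf.map_cong) (auto simp: k_def tup_def)
    finally show ?thesis by (simp add: qf.map_id)
  qed
  have "sat N (tup u v) \<psi>"
    using \<phi> eq sat_map[of N id "tup u v" \<psi>] by (simp add: diag_def)
  moreover have "\<psi> \<in> formulas L {1, 2}"
    using \<phi> by (auto simp: \<psi>_def formulas_def diag_def qf.set_map k_def)
  ultimately show "\<phi> \<in> inst (qftp L N u v) u v"
    using eq by (auto simp: inst_def qftp_def intro!: image_eqI[of _ _ \<psi>])
qed

text \<open>
  Distances are attached to unordered pairs, which makes them symmetric. They are natural numbers,
  and nothing is said about \<open>d {x}\<close>.
\<close>

definition dist_structure :: "nat \<Rightarrow> 'v set \<Rightarrow> ('v set \<Rightarrow> nat) \<Rightarrow> (nat, 'v) rstruct" where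
  "dist_structure r V d =
     \<lparr>univ = V,
      rel = (\<lambda>i. if i \<in> {1..r} then {(x, y). x \<in> V \<and> y \<in> V \<and> x \<noteq> y \<and> d {x, y} = i} else {})\<rparr>"

lemma univ_dist_structure [simp]: "univ (dist_structure r V d) = V"
  by (simp add: dist_structure_def)

lemma rel_dist_structure:
  "(x, y) \<in> rel (dist_structure r V d) i \<longleftrightarrow>
     i \<in> {1..r} \<and> x \<in> V \<and> y \<in> V \<and> x \<noteq> y \<and> d {x, y} = i"
  by (auto simp: dist_structure_def)

lemma is_structure_dist_structure [simp]: "is_structure {1..r} (dist_structure r V d)"
  by (auto simp: is_structure_def dist_structure_def)

definition metric_on :: "nat \<Rightarrow> 'v set \<Rightarrow> ('v set \<Rightarrow> nat) \<Rightarrow> bool" where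
  "metric_on r V d \<longleftrightarrow> (\<forall>A\<in>pairs V. d A \<in> {1..r}) \<and>
     (\<forall>x\<in>V. \<forall>y\<in>V. \<forall>z\<in>V. x \<noteq> y \<longrightarrow> y \<noteq> z \<longrightarrow> x \<noteq> z \<longrightarrow> d {x, z} \<le> d {x, y} + d {y, z})"

text \<open>
  Together with the converse below, this identifies the class of metric spaces with the structures
  of integer metrics on finite sets, without reference to an isomorphic copy on \<open>{1..n}\<close>.
\<close>

lemma metric_class_imp_dist_structure:
  assumes "N \<in> metric_class r"
  obtains V d where "finite V" "metric_on r V d" "N = dist_structure r V d"
proof -
  have N: "is_structure {1..r} N" using assms by (simp add: metric_class_def)
  obtain n :: nat and e where e: "Metric_space {1..n} e"
    and er: "\<forall>x\<in>{1..n}. \<forall>y\<in>{1..n}. x \<noteq> y \<longrightarrow> e x y \<in> real ` {1..r}"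
    and iso: "isomorphic {1..r} N (metric_structure r {1..n} e)"
    using assms unfolding metric_class_def mem_Collect_eq by (elim conjE exE)
  obtain f where "bij_betw f (univ N) (univ (metric_structure r {1..n} e))"
    and rel: "\<forall>s\<in>{1..r}. \<forall>x\<in>univ N. \<forall>y\<in>univ N.
      (x, y) \<in> rel N s \<longleftrightarrow> (f x, f y) \<in> rel (metric_structure r {1..n} e) s"
    using iso unfolding isomorphic_def by (elim conjE exE)
  then have f: "bij_betw f (univ N) {1..n}" by (simp add: metric_structure_def)
  define V where "V = univ N"
  have fV: "f x \<in> {1..n}" if "x \<in> V" for x using f that by (auto simp: V_def bij_betw_def)
  have inj: "f x = f y \<longleftrightarrow> x = y" if "x \<in> V" "y \<in> V" for x y
    using f that by (auto simp: V_def bij_betw_def inj_on_def)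
  \<comment> \<open>Either enumeration of \<open>A\<close> gives the same value, as \<open>e\<close> is symmetric.\<close>
  define d where "d A = (SOME i. \<exists>x y. A = {x, y} \<and> real i = e (f x) (f y))" for A
  have comm: "e x y = e y x" for x y using e by (simp add: Metric_space_def)
  have d: "real (d {x, y}) = e (f x) (f y)" if xy: "x \<in> V" "y \<in> V" "x \<noteq> y" for x y
  proof -
    have "e (f x) (f y) \<in> real ` {1..r}" using er xy inj fV by simp
    then obtain i where i: "real i = e (f x) (f y)" by auto
    have "\<exists>x' y'. {x, y} = {x', y'} \<and> real (d {x, y}) = e (f x') (f y')"
      unfolding d_def by (rule someI[of _ i]) (use i in blast)
    then show ?thesis using comm by (auto simp: doubleton_eq_iff)
  qed
  have "d A \<in> {1..r}" if "A \<in> pairs V" for A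
  proof -
    from that obtain x y where A: "A = {x, y}" "x \<in> V" "y \<in> V" "x \<noteq> y" by (rule pairsE) auto
    then have "real (d A) \<in> real ` {1..r}" using er inj fV d[of x y] by simp
    then show ?thesis by (auto simp del: atLeastAtMost_iff)
  qed
  moreover have "d {x, z} \<le> d {x, y} + d {y, z}"
    if "x \<in> V" "y \<in> V" "z \<in> V" "x \<noteq> y" "y \<noteq> z" "x \<noteq> z" for x y z
  proof -
    have "e (f x) (f z) \<le> e (f x) (f y) + e (f y) (f z)"
      using e that fV by (simp add: Metric_space_def)
    then show ?thesis using that by (simp add: d[symmetric])
  qed
  ultimately have "metric_on r V d" by (auto simp: metric_on_def)
  moreover have "finite V" using f by (simp add: V_def bij_betw_finite)
  moreover have "N = dist_structure r V d"
  proof -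
    have e0: "e (f x) (f x) = 0" if "x \<in> V" for x
      using e fV[OF that] by (auto simp: Metric_space_def)
    have "(x, y) \<in> rel N i \<longleftrightarrow> (x, y) \<in> rel (dist_structure r V d) i" for x y i
    proof (cases "i \<in> {1..r} \<and> x \<in> V \<and> y \<in> V")
      case True
      then have "(x, y) \<in> rel N i \<longleftrightarrow> e (f x) (f y) = real i"
        using rel fV by (auto simp: V_def metric_structure_def)
      also have "\<dots> \<longleftrightarrow> x \<noteq> y \<and> d {x, y} = i"
        using True e0[of x] d[of x y] by (cases "x = y") auto
      finally show ?thesis using True by (simp add: rel_dist_structure)
    next
      case False
      then have "(x, y) \<notin> rel N i" using N by (auto simp: is_structure_def V_def)
      with False show ?thesis by (auto simp: rel_dist_structure)
    qed
    then have "rel N = rel (dist_structure r V d)" by (intro ext) auto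
    then show ?thesis by (simp add: V_def)
  qed
  ultimately show ?thesis using that by blast
qed

lemma dist_structure_in_metric_class:
  assumes "finite V" "metric_on r V d"
  shows "dist_structure r V d \<in> metric_class r"
proof -
  from assms(1) obtain h where h: "bij_betw h {1..card V} V"
    using ex_bij_betw_nat_finite_1 by blast
  define e where "e i j = (if i = j then 0 else real (d {h i, h j}))" for i j
  have hV: "h i \<in> V" if "i \<in> {1..card V}" for i
    using bij_betw_apply[OF h that] .
  have inj: "h i = h j \<longleftrightarrow> i = j" if "i \<in> {1..card V}" "j \<in> {1..card V}" for i j
    using inj_on_eq_iff[OF bij_betw_imp_inj_on[OF h] that] .
  have dr: "d {h i, h j} \<in> {1..r}" if "i \<in> {1..card V}" "j \<in> {1..card V}" "i \<noteq> j" for i j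
    using assms(2) hV inj that pairsI[of "h i" V "h j"] by (simp add: metric_on_def)
  have "Metric_space {1..card V} e"
  proof
    show "0 \<le> e i j" "e i j = e j i" for i j by (auto simp: e_def insert_commute)
  next
    fix i j assume "i \<in> {1..card V}" "j \<in> {1..card V}"
    with dr[of i j] show "e i j = 0 \<longleftrightarrow> i = j" by (auto simp: e_def)
  next
    fix i j k assume ijk: "i \<in> {1..card V}" "j \<in> {1..card V}" "k \<in> {1..card V}"
    show "e i k \<le> e i j + e j k"
    proof (cases "i = j \<or> j = k \<or> i = k")
      case True
      then show ?thesis by (auto simp: e_def)
    next
      case False
      then have "d {h i, h k} \<le> d {h i, h j} + d {h j, h k}"
        using assms(2) hV inj ijk by (auto simp: metric_on_def)
      with False show ?thesis by (simp add: e_def)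
    qed
  qed
  moreover have "e i j \<in> real ` {1..r}" if "i \<in> {1..card V}" "j \<in> {1..card V}" "i \<noteq> j" for i j
    using dr[OF that] that by (simp add: e_def)
  moreover have "isomorphic {1..r} (dist_structure r V d) (metric_structure r {1..card V} e)"
    unfolding isomorphic_def
  proof (intro exI conjI ballI)
    let ?f = "inv_into {1..card V} h"
    show f: "bij_betw ?f (univ (dist_structure r V d)) (univ (metric_structure r {1..card V} e))"
      using bij_betw_inv_into[OF h] by (simp add: metric_structure_def)
    fix s x y
    assume s: "s \<in> {1..r}" and xy: "x \<in> univ (dist_structure r V d)" "y \<in> univ (dist_structure r V d)"
    then have hf: "h (?f x) = x" "h (?f y) = y" "?f x \<in> {1..card V}" "?f y \<in> {1..card V}"
      using bij_betw_inv_into_right[OF h] bij_betw_apply[OF bij_betw_inv_into[OF h]] by simp_all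
    then have "?f x = ?f y \<longleftrightarrow> x = y" by metis
    then show "(x, y) \<in> rel (dist_structure r V d) s \<longleftrightarrow>
        (?f x, ?f y) \<in> rel (metric_structure r {1..card V} e) s"
      using s xy hf by (auto simp: rel_dist_structure metric_structure_def e_def)
  qed
  ultimately show ?thesis
    unfolding metric_class_def by (intro CollectI conjI is_structure_dist_structure exI[of _ "card V"] exI[of _ e]) simp_all
qed

text \<open>
  The type \<open>p\<^sub>i\<close> of two points at distance \<open>i\<close>, read off from a two-point space.
\<close>

definition dist_type :: "nat \<Rightarrow> nat \<Rightarrow> (nat, nat) qf set" where
  "dist_type r i = qftp {1..r} (dist_structure r {1, 2 :: nat} (\<lambda>_. i)) 1 2"

text \<open>
  The diagram of a pair \<open>A\<close> at distance \<open>i\<close>. It depends on the set \<open>A\<close> and not on its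
  enumeration, so it describes both \<open>p\<^sub>i(c\<^sub>u, c\<^sub>v)\<close> and \<open>p\<^sub>i(c\<^sub>v, c\<^sub>u)\<close>.
\<close>

definition dist_diag :: "nat \<Rightarrow> nat \<Rightarrow> 'v set \<Rightarrow> (nat, 'v) qf set" where
  "dist_diag r i A = diag {1..r} (dist_structure r A (\<lambda>_. i)) A"

lemma qftp_dist_structure:
  assumes "u \<in> V" "v \<in> V" "u \<noteq> v"
  shows "qftp {1..r} (dist_structure r V d) u v = dist_type r (d {u, v})"
proof -
  have "sat (dist_structure r V d) (tup u v) \<phi> \<longleftrightarrow>
      sat (dist_structure r {1, 2 :: nat} (\<lambda>_. d {u, v})) (tup 1 2) \<phi>"
    if "\<phi> \<in> formulas {1..r} {1, 2}" for \<phi>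
    using that assms by (intro sat_cong) (auto simp: rel_dist_structure insert_commute)
  then show ?thesis by (auto simp: dist_type_def qftp_def)
qed

lemma diag_dist_structure:
  assumes "A \<subseteq> V" "card A = 2"
  shows "diag {1..r} (dist_structure r V d) A = dist_diag r (d A) A"
proof -
  obtain u v where A: "A = {u, v}" "u \<noteq> v" using assms(2) by (auto simp: card_2_iff)
  have "sat (dist_structure r V d) id \<phi> \<longleftrightarrow> sat (dist_structure r A (\<lambda>_. d A)) id \<phi>"
    if "\<phi> \<in> formulas {1..r} A" for \<phi>
    using that assms by (intro sat_cong) (auto simp: rel_dist_structure A insert_commute)
  then show ?thesis by (auto simp: dist_diag_def diag_def)
qed

lemma inst_dist_type:
  assumes "u \<noteq> v"
  shows "inst (dist_type r i) u v = dist_diag r i {u, v}"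
  using inst_qftp[OF assms, of "{1..r}" "dist_structure r {u, v} (\<lambda>_. i)"] assms
  by (simp add: qftp_dist_structure dist_diag_def del: One_nat_def)

lemma dist_diag_inj:
  assumes "dist_diag r i A = dist_diag r j A" "card A = 2" "i \<in> {1..r}"
  shows "i = j"
proof -
  obtain u v where A: "A = {u, v}" "u \<noteq> v" using assms(2) by (auto simp: card_2_iff)
  have "Rel i u v \<in> dist_diag r i A"
    using assms(3) A by (auto simp: dist_diag_def diag_def formulas_def rel_dist_structure)
  with assms(1) have "Rel i u v \<in> dist_diag r j A" by simp
  then show ?thesis by (auto simp: dist_diag_def diag_def rel_dist_structure)
qed

text \<open>
  Distance is symmetric, so exchanging the variables fixes every type \<open>p\<^sub>i\<close>. Consequently the
  symmetry condition on templates says exactly that each relation is symmetric.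
\<close>

lemma dist_type_permute:
  assumes "\<mu> permutes {1, 2}"
  shows "map_qf id \<mu> ` dist_type r i = dist_type r i"
proof -
  \<comment> \<open>Over the points \<open>1\<close>, \<open>2\<close> a type is its own instance, so swapping variables amounts to
      listing the pair \<open>{1, 2}\<close> in the other order.\<close>
  have "map_qf id (tup 1 2) \<phi> = \<phi>" if "\<phi> \<in> dist_type r i" for \<phi>
  proof -
    have "map_qf id (tup 1 2) \<phi> = map_qf id id \<phi>"
      using that by (intro qf.map_cong) (auto simp: dist_type_def qftp_def formulas_def)
    then show ?thesis by (simp add: qf.map_id)
  qed
  then have id: "inst (dist_type r i) 1 2 = dist_type r i" by (simp add: inst_def)
  have "\<mu> 1 \<in> {1, 2}" "\<mu> 2 \<in> {1, 2}" "\<mu> 1 \<noteq> \<mu> 2"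
    using permutes_in_image[OF assms, of 1] permutes_in_image[OF assms, of 2]
      inj_eq[OF permutes_inj[OF assms], of 1 2] by simp_all
  then have \<mu>: "{\<mu> 1, \<mu> 2} = {1, 2}" by auto
  have "map_qf id \<mu> \<phi> = map_qf id (tup (\<mu> 1) (\<mu> 2)) \<phi>" if "\<phi> \<in> dist_type r i" for \<phi>
    using that by (intro qf.map_cong) (auto simp: dist_type_def qftp_def formulas_def)
  then have "map_qf id \<mu> ` dist_type r i = inst (dist_type r i) (\<mu> 1) (\<mu> 2)"
    by (auto simp: inst_def)
  also have "\<dots> = inst (dist_type r i) 1 2"
    using \<mu> \<open>\<mu> 1 \<noteq> \<mu> 2\<close> by (simp add: inst_dist_type)
  finally show ?thesis using id by simp
qed

lemma dist_type_inj:
  assumes "dist_type r i = dist_type r j" "i \<in> {1..r}"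
  shows "i = j"
proof (rule dist_diag_inj[of r i "{1, 2 :: nat}" j])
  show "dist_diag r i {1, 2 :: nat} = dist_diag r j {1, 2}"
    using assms(1) inst_dist_type[of "1 :: nat" 2 r] by (metis one_eq_numeral_iff num.distinct(1))
qed (use assms(2) in simp_all)

text \<open>
  Two distinct points in the type of points are needed to realize the types at all: over a
  one-point type there are no types of pairs of distinct points.
\<close>

lemma S2_metric_class:
  assumes "u \<noteq> (v :: 'v)"
  shows "S2 {1..r} (metric_class r :: (nat, 'v) rstruct set) = dist_type r ` {1..r}"
proof (intro equalityI subsetI)
  fix p assume p: "p \<in> S2 {1..r} (metric_class r :: (nat, 'v) rstruct set)"
  then obtain N :: "(nat, 'v) rstruct" and a b
    where N: "N \<in> metric_class r" "a \<in> univ N" "b \<in> univ N"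
      and sat: "\<And>\<phi>. \<phi> \<in> p \<Longrightarrow> sat N (tup a b) \<phi>"
    unfolding S2_def by blast
  have pf: "p \<subseteq> formulas {1..r} {1, 2}" "Neg (Equal 1 2) \<in> p"
    and compl: "\<And>\<phi>. \<phi> \<in> formulas {1..r} {1, 2} \<Longrightarrow> \<phi> \<in> p \<or> Neg \<phi> \<in> p"
    using p unfolding S2_def by blast+
  have ab: "a \<noteq> b" using sat[OF pf(2)] by simp
  have "p = qftp {1..r} N a b"
  proof (intro equalityI subsetI)
    fix \<phi> assume "\<phi> \<in> p"
    then show "\<phi> \<in> qftp {1..r} N a b" using pf sat by (auto simp: qftp_def)
  next
    fix \<phi> assume \<phi>: "\<phi> \<in> qftp {1..r} N a b"
    then have "Neg \<phi> \<notin> p" using sat[of "Neg \<phi>"] by (auto simp: qftp_def)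
    with \<phi> compl show "\<phi> \<in> p" by (auto simp: qftp_def)
  qed
  moreover obtain V d where "metric_on r V d" "N = dist_structure r V d"
    using metric_class_imp_dist_structure[OF N(1)] by metis
  ultimately show "p \<in> dist_type r ` {1..r}"
    using N(2,3) ab by (auto simp: qftp_dist_structure metric_on_def intro!: imageI dest: pairsI)
next
  fix p assume "p \<in> dist_type r ` {1..r}"
  then obtain i where i: "i \<in> {1..r}" and p: "p = dist_type r i" by blast
  let ?N = "dist_structure r {u, v} (\<lambda>_. i)"
  have "metric_on r {u, v} (\<lambda>_. i)" using i by (auto simp: metric_on_def)
  then have N: "?N \<in> metric_class r" by (intro dist_structure_in_metric_class) auto
  have p': "p = qftp {1..r} ?N u v" using p assms by (simp add: qftp_dist_structure)
  show "p \<in> S2 {1..r} (metric_class r :: (nat, 'v) rstruct set)"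
    unfolding S2_def
  proof (intro CollectI conjI bexI[OF _ N])
    show "p \<subseteq> formulas {1..r} {1, 2}" "Neg (Equal 1 2) \<in> p"
      using assms by (auto simp: p' qftp_def formulas_def)
    show "\<forall>\<phi>\<in>formulas {1..r} {1, 2}. \<phi> \<in> p \<or> Neg \<phi> \<in> p"
      by (auto simp: p' qftp_def formulas_def)
    show "\<exists>a\<in>univ ?N. \<exists>b\<in>univ ?N. \<forall>\<phi>\<in>p. sat ?N (tup a b) \<phi>"
      by (auto simp: p' qftp_def)
  qed
qed


section \<open>Templates as assignments of sets of distances\<close>

definition palette_template ::
    "nat \<Rightarrow> 'v set \<Rightarrow> ('v set \<Rightarrow> nat set) \<Rightarrow> (nat, 'v) pstruct" where
  "palette_template r V c =
     \<lparr>univ = V,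
      rel = (\<lambda>p. {(u, v). u \<in> V \<and> v \<in> V \<and> u \<noteq> v \<and> p \<in> dist_type r ` c {u, v}})\<rparr>"

definition palette :: "nat \<Rightarrow> 'v set \<Rightarrow> ('v set \<Rightarrow> nat set) \<Rightarrow> bool" where
  "palette r V c \<longleftrightarrow> (\<forall>A\<in>pairs V. c A \<noteq> {} \<and> c A \<subseteq> {1..r})"

lemma univ_palette_template [simp]: "univ (palette_template r V c) = V"
  by (simp add: palette_template_def)

lemma rel_palette_template:
  "(u, v) \<in> rel (palette_template r V c) p \<longleftrightarrow>
     u \<in> V \<and> v \<in> V \<and> u \<noteq> v \<and> p \<in> dist_type r ` c {u, v}"
  by (simp add: palette_template_def)

lemma palette_mem: "palette r V c \<Longrightarrow> A \<in> pairs V \<Longrightarrow> i \<in> c A \<Longrightarrow> i \<in> {1..r}"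
  unfolding palette_def by blast

lemma palette_card_pos:
  assumes "palette r V c" "A \<in> pairs V"
  shows "0 < card (c A)"
proof -
  have "c A \<noteq> {}" "c A \<subseteq> {1..r}" using assms by (simp_all add: palette_def)
  then show ?thesis using finite_subset[of "c A" "{1..r}"] by (simp add: card_gt_0_iff)
qed

lemma palette_subset:
  "palette r V c \<Longrightarrow> u \<in> V \<Longrightarrow> v \<in> V \<Longrightarrow> u \<noteq> v \<Longrightarrow> c {u, v} \<subseteq> {1..r}"
  by (simp add: palette_def pairsI)

lemma two_le_cardE:
  assumes "2 \<le> card V"
  obtains u v where "u \<noteq> v" "u \<in> V" "v \<in> V"
proof -
  obtain A where "A \<subseteq> V" "card A = 2" using obtain_subset_with_card_n[OF assms] by metis
  then show ?thesis using that by (auto simp: card_2_iff)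
qed

lemma template_palette_template:
  fixes V :: "'v set"
  assumes c: "palette r V c" and V: "2 \<le> card V"
  shows "template {1..r} (metric_class r) (palette_template r V c)"
proof -
  obtain u\<^sub>0 v\<^sub>0 where "u\<^sub>0 \<noteq> (v\<^sub>0 :: 'v)"
    using V by (rule two_le_cardE)
  note S2 = S2_metric_class[OF this, of r]
  have rel: "(u, v) \<in> rel (palette_template r V c) (dist_type r i) \<longleftrightarrow>
      u \<in> V \<and> v \<in> V \<and> u \<noteq> v \<and> i \<in> c {u, v}" if "i \<in> {1..r}" for u v i
    using that dist_type_inj[of r i] by (auto simp: rel_palette_template)
  show ?thesis
    unfolding template_def complete_structure_def is_structure_def S2
  proof (intro conjI allI ballI impI)
    fix p assume "p \<notin> dist_type r ` {1..r}"
    then show "rel (palette_template r V c) p = {}"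
      using palette_subset[OF c] by (fastforce simp: palette_template_def)
  next
    fix u v assume uv: "u \<in> univ (palette_template r V c)" "v \<in> univ (palette_template r V c)" "u \<noteq> v"
    then obtain i where "i \<in> c {u, v}"
      using c pairsI[of u V v] by (auto simp: palette_def)
    moreover have "i \<in> {1..r}"
      using palette_mem[OF c pairsI calculation] uv by simp
    ultimately show "\<exists>p\<in>dist_type r ` {1..r}. (u, v) \<in> rel (palette_template r V c) p \<or>
        (v, u) \<in> rel (palette_template r V c) p"
      using uv by (auto simp: rel)
  next
    fix p p' \<mu> and a :: "nat \<Rightarrow> 'v"
    assume p: "p \<in> dist_type r ` {1..r}" "p' \<in> dist_type r ` {1..r}"
      and \<mu>: "\<mu> permutes {1, 2}" and eq: "p = map_qf id \<mu> ` p'"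
      and a: "a 1 \<in> univ (palette_template r V c)" "a 2 \<in> univ (palette_template r V c)" "a 1 \<noteq> a 2"
    from p obtain i where i: "p' = dist_type r i" "i \<in> {1..r}" by auto
    then have p': "p = p'" using eq dist_type_permute[OF \<mu>] by simp
    have "\<mu> 1 \<in> {1, 2}" "\<mu> 2 \<in> {1, 2}" "\<mu> 1 \<noteq> \<mu> 2"
      using permutes_in_image[OF \<mu>, of 1] permutes_in_image[OF \<mu>, of 2]
        inj_eq[OF permutes_inj[OF \<mu>], of 1 2] by simp_all
    then have "\<mu> 1 = 1 \<and> \<mu> 2 = 2 \<or> \<mu> 1 = 2 \<and> \<mu> 2 = 1" by auto
    then show "(a 1, a 2) \<in> rel (palette_template r V c) p \<longleftrightarrow>
        (a (\<mu> 1), a (\<mu> 2)) \<in> rel (palette_template r V c) p'"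
      using a i by (auto simp: p' rel insert_commute)
  qed (auto simp: rel_palette_template palette_template_def)
qed

text \<open>
  Completeness makes the sets of allowed distances nonempty; irreflexivity and symmetry make the
  relations recoverable from these sets.
\<close>

lemma template_imp_palette_template:
  fixes M :: "(nat, 'v) pstruct"
  assumes M: "template {1..r} (metric_class r) M" and V: "2 \<le> card (univ M)"
  obtains c where "palette r (univ M) c" "M = palette_template r (univ M) c"
proof -
  obtain u\<^sub>0 v\<^sub>0 where "u\<^sub>0 \<noteq> (v\<^sub>0 :: 'v)"
    using V by (rule two_le_cardE)
  note S2 = S2_metric_class[OF this, of r]
  let ?V = "univ M"
  note t = M[unfolded template_def complete_structure_def is_structure_def S2]
  note str = t[THEN conjunct1, THEN conjunct1]
    and compl = t[THEN conjunct1, THEN conjunct2]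
    and irrefl = t[THEN conjunct2, THEN conjunct1]
    and perm = t[THEN conjunct2, THEN conjunct2, rule_format]
  have sym: "(u, v) \<in> rel M (dist_type r i) \<longleftrightarrow> (v, u) \<in> rel M (dist_type r i)"
    if "i \<in> {1..r}" "u \<in> ?V" "v \<in> ?V" "u \<noteq> v" for i u v
  proof -
    have \<mu>: "Transposition.transpose 1 2 permutes {1, 2 :: nat}" by (rule permutes_swap_id) auto
    show ?thesis
      using perm[of "dist_type r i" "dist_type r i" "Transposition.transpose 1 2" "tup u v"] that
        dist_type_permute[OF \<mu>, of r i] \<mu> by simp
  qed
  define c where "c A = {i \<in> {1..r}. \<exists>u v. A = {u, v} \<and> (u, v) \<in> rel M (dist_type r i)}" for A
  have c: "i \<in> c {u, v} \<longleftrightarrow> i \<in> {1..r} \<and> (u, v) \<in> rel M (dist_type r i)"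
    if "u \<in> ?V" "v \<in> ?V" "u \<noteq> v" for i u v
    using that sym[of i u v] by (auto simp: c_def doubleton_eq_iff)
  have "palette r ?V c"
    unfolding palette_def
  proof (intro ballI conjI)
    fix A assume "A \<in> pairs ?V"
    then obtain u v where A: "A = {u, v}" "u \<noteq> v" "u \<in> ?V" "v \<in> ?V" by (rule pairsE)
    then obtain p where "p \<in> dist_type r ` {1..r}" "(u, v) \<in> rel M p \<or> (v, u) \<in> rel M p"
      using compl[rule_format, OF A(3,4,2)] by (elim bexE)
    then obtain i where "i \<in> {1..r}" "(u, v) \<in> rel M (dist_type r i)"
      using sym[OF _ A(3,4,2)] by blast
    then show "c A \<noteq> {}" using c[OF A(3,4,2)] A(1) by blast
    show "c A \<subseteq> {1..r}" by (auto simp: c_def)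
  qed
  moreover have "M = palette_template r ?V c"
  proof -
    have "(u, v) \<in> rel M p \<longleftrightarrow> (u, v) \<in> rel (palette_template r ?V c) p" for u v p
    proof (cases "p \<in> dist_type r ` {1..r}")
      case True
      then obtain i where i: "i \<in> {1..r}" "p = dist_type r i" by blast
      have "u \<in> ?V \<and> v \<in> ?V \<and> u \<noteq> v" if "(u, v) \<in> rel M p"
        using str[THEN conjunct1, rule_format, OF True] irrefl[rule_format, OF True, of u] that
        by blast
      moreover have "p \<in> dist_type r ` c {u, v} \<longleftrightarrow> (u, v) \<in> rel M p"
        if "u \<in> ?V \<and> v \<in> ?V \<and> u \<noteq> v"
        using c[of u v] that i dist_type_inj[of r i] by auto
      ultimately show ?thesis by (auto simp: rel_palette_template)
    next
      case False
      then have "(u, v) \<notin> rel M p" using str[THEN conjunct2, rule_format, OF False] by simp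
      with False show ?thesis using c[of u v] by (auto simp: rel_palette_template)
    qed
    then have "rel M = rel (palette_template r ?V c)" by (intro ext) auto
    then show ?thesis by simp
  qed
  ultimately show ?thesis using that by blast
qed

lemma Ch_palette_template:
  fixes V :: "'v set"
  assumes c: "palette r V c" and A: "A \<in> pairs V"
  shows "Ch {1..r} (metric_class r) (palette_template r V c) A = (\<lambda>i. dist_diag r i A) ` c A"
proof -
  obtain u v where uv: "A = {u, v}" "u \<noteq> v" "u \<in> V" "v \<in> V" using A by (rule pairsE)
  note S2 = S2_metric_class[OF uv(2), of r]
  show ?thesis
  proof (intro equalityI subsetI)
    fix q assume "q \<in> Ch {1..r} (metric_class r) (palette_template r V c) A"
    then obtain a b i where "q = inst (dist_type r i) a b" "{a, b} = A" "a \<noteq> b" "i \<in> c {a, b}"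
      by (auto simp: Ch_def rel_palette_template)
    then show "q \<in> (\<lambda>i. dist_diag r i A) ` c A" by (auto simp: inst_dist_type)
  next
    fix q assume "q \<in> (\<lambda>i. dist_diag r i A) ` c A"
    then obtain i where i: "q = dist_diag r i A" "i \<in> c A" by auto
    then have p: "dist_type r i \<in> S2 {1..r} (metric_class r :: (nat, 'v) rstruct set)"
      using palette_mem[OF c A] by (auto simp: S2 simp del: atLeastAtMost_iff)
    have q: "q = inst (dist_type r i) u v" using i uv by (simp add: inst_dist_type)
    have "q \<in> S2C {1..r} (metric_class r) V"
      unfolding S2C_def using q p uv by blast
    moreover have "(u, v) \<in> rel (palette_template r V c) (dist_type r i)"
      using i uv by (simp add: rel_palette_template)
    ultimately show "q \<in> Ch {1..r} (metric_class r) (palette_template r V c) A"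
      unfolding Ch_def univ_palette_template using q p uv(1) by blast
  qed
qed

text \<open>
  The diagrams of the pairs determine a structure. With at least two points every point lies in a
  pair, so even the atoms \<open>R\<^sub>i(x, x)\<close> are covered.
\<close>

lemma full_subpattern_by_palette_template:
  fixes V :: "'v set"
  assumes c: "palette r V c" and V: "2 \<le> card V" and d: "\<And>A. A \<in> pairs V \<Longrightarrow> d A \<in> c A"
    and \<xi>: "\<And>A. A \<in> pairs V \<Longrightarrow> \<xi> A = dist_diag r (d A) A"
  shows "full_subpattern_by {1..r} (metric_class r) \<xi> N (palette_template r V c) \<longleftrightarrow>
    N = dist_structure r V d"
proof
  assume N: "N = dist_structure r V d"
  show "full_subpattern_by {1..r} (metric_class r) \<xi> N (palette_template r V c)"
    unfolding full_subpattern_by_def choice_function_def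
    using d \<xi> by (auto simp: N Ch_palette_template[OF c] diag_dist_structure pairs_def)
next
  assume "full_subpattern_by {1..r} (metric_class r) \<xi> N (palette_template r V c)"
  then have N: "is_structure {1..r} N" "univ N = V"
    and diag: "\<And>A. A \<in> pairs V \<Longrightarrow> diag {1..r} N A = dist_diag r (d A) A"
    using \<xi> by (auto simp: full_subpattern_by_def)
  have "(x, y) \<in> rel N i \<longleftrightarrow> (x, y) \<in> rel (dist_structure r V d) i" for x y i
  proof (cases "i \<in> {1..r} \<and> x \<in> V \<and> y \<in> V")
    case True
    obtain A where A: "A \<in> pairs V" "x \<in> A" "y \<in> A"
    proof (cases "x = y")
      case True
      have "V \<noteq> {x}" using V by auto
      then obtain z where "z \<in> V" "z \<noteq> x" using \<open>i \<in> {1..r} \<and> x \<in> V \<and> y \<in> V\<close> by auto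
      then show ?thesis using that[of "{x, z}"] True \<open>i \<in> {1..r} \<and> x \<in> V \<and> y \<in> V\<close> by (simp add: pairsI)
    next
      case False
      then show ?thesis using that[of "{x, y}"] True by (simp add: pairsI)
    qed
    have "Rel i x y \<in> formulas {1..r} A" using True A by (auto simp: formulas_def)
    then have "(x, y) \<in> rel N i \<longleftrightarrow> Rel i x y \<in> diag {1..r} N A"
      by (simp add: diag_def)
    also have "\<dots> \<longleftrightarrow> Rel i x y \<in> diag {1..r} (dist_structure r V d) A"
      using diag[OF A(1)] A(1) by (simp add: diag_dist_structure pairs_def)
    also have "\<dots> \<longleftrightarrow> (x, y) \<in> rel (dist_structure r V d) i"
      using \<open>Rel i x y \<in> formulas {1..r} A\<close> by (simp add: diag_def)
    finally show ?thesis .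
  next
    case False
    then have "(x, y) \<notin> rel N i" using N by (auto simp: is_structure_def)
    with False show ?thesis by (auto simp: rel_dist_structure)
  qed
  then have "rel N = rel (dist_structure r V d)" by (intro ext) auto
  with N show "N = dist_structure r V d" by simp
qed

lemma choice_function_palette_template:
  fixes V :: "'v set"
  assumes c: "palette r V c"
  shows "choice_function {1..r} (metric_class r) (palette_template r V c) \<xi> \<longleftrightarrow>
    (\<exists>d. \<forall>A\<in>pairs V. d A \<in> c A \<and> \<xi> A = dist_diag r (d A) A)"
proof -
  have "choice_function {1..r} (metric_class r) (palette_template r V c) \<xi> \<longleftrightarrow>
      (\<forall>A\<in>pairs V. \<exists>i. i \<in> c A \<and> \<xi> A = dist_diag r i A)"
    by (auto simp: choice_function_def Ch_palette_template[OF c])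
  also have "\<dots> \<longleftrightarrow> (\<exists>d. \<forall>A\<in>pairs V. d A \<in> c A \<and> \<xi> A = dist_diag r (d A) A)"
    by (rule bchoice_iff)
  finally show ?thesis .
qed

text \<open>
  By the previous lemmas subpatterns correspond to choices of a distance in \<open>c A\<close> for each pair
  \<open>A\<close>, and different choices give different structures.
\<close>

lemma sub_palette_template:
  fixes V :: "'v set"
  assumes c: "palette r V c" and V: "finite V" "2 \<le> card V"
  shows "sub {1..r} (metric_class r) (palette_template r V c) = (\<Prod>A\<in>pairs V. card (c A))"
proof -
  let ?M = "palette_template r V c" and ?F = "Pi\<^sub>E (pairs V) c"
  have "full_subpattern {1..r} (metric_class r) N ?M \<longleftrightarrow> N \<in> dist_structure r V ` ?F" for N
  proof
    assume "full_subpattern {1..r} (metric_class r) N ?M"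
    then obtain \<xi> where \<xi>: "full_subpattern_by {1..r} (metric_class r) \<xi> N ?M"
      by (auto simp: full_subpattern_def)
    then have "choice_function {1..r} (metric_class r) ?M \<xi>" by (simp add: full_subpattern_by_def)
    then obtain d where d: "\<forall>A\<in>pairs V. d A \<in> c A \<and> \<xi> A = dist_diag r (d A) A"
      by (auto simp only: choice_function_palette_template[OF c])
    let ?d = "restrict d (pairs V)"
    have "full_subpattern_by {1..r} (metric_class r) \<xi> N ?M \<longleftrightarrow> N = dist_structure r V ?d"
      by (rule full_subpattern_by_palette_template[OF c V(2)]) (use d in auto)
    with \<xi> have "N = dist_structure r V ?d" by simp
    moreover have "?d \<in> ?F" using d by auto
    ultimately show "N \<in> dist_structure r V ` ?F" by blast
  next
    assume "N \<in> dist_structure r V ` ?F"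
    then obtain d where d: "d \<in> ?F" "N = dist_structure r V d" by auto
    have "full_subpattern_by {1..r} (metric_class r) (\<lambda>A. dist_diag r (d A) A) N ?M \<longleftrightarrow>
        N = dist_structure r V d"
      by (rule full_subpattern_by_palette_template[OF c V(2)]) (use d in auto)
    then have "full_subpattern_by {1..r} (metric_class r) (\<lambda>A. dist_diag r (d A) A) N ?M"
      using d(2) by simp
    then show "full_subpattern {1..r} (metric_class r) N ?M" by (auto simp: full_subpattern_def)
  qed
  then have "sub {1..r} (metric_class r) ?M = card (dist_structure r V ` ?F)"
    by (simp add: sub_def)
  also have "\<dots> = card ?F"
  proof (rule card_image, rule inj_onI)
    fix d d' assume d: "d \<in> ?F" "d' \<in> ?F" and eq: "dist_structure r V d = dist_structure r V d'"
    show "d = d'"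
    proof (rule PiE_ext[OF d])
      fix A assume A: "A \<in> pairs V"
      then have "dist_diag r (d A) A = dist_diag r (d' A) A"
        using eq diag_dist_structure[of A V r d] diag_dist_structure[of A V r d']
        by (auto simp: pairs_def)
      moreover have "card A = 2" using A by (simp add: pairs_def)
      moreover have "d A \<in> {1..r}" using palette_mem[OF c A PiE_mem[OF d(1) A]] .
      ultimately show "d A = d' A" by (rule dist_diag_inj)
    qed
  qed
  also have "\<dots> = (\<Prod>A\<in>pairs V. card (c A))"
    using V by (simp add: card_PiE finite_pairs)
  finally show ?thesis .
qed

definition metric_palette :: "'v set \<Rightarrow> ('v set \<Rightarrow> nat set) \<Rightarrow> bool" where
  "metric_palette V c \<longleftrightarrow> (\<forall>x\<in>V. \<forall>y\<in>V. \<forall>z\<in>V. x \<noteq> y \<longrightarrow> y \<noteq> z \<longrightarrow> x \<noteq> z \<longrightarrow>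
     (\<forall>i\<in>c {x, z}. \<forall>j\<in>c {x, y}. \<forall>k\<in>c {y, z}. i \<le> j + k))"

lemma random_palette_template_iff:
  fixes V :: "'v set"
  assumes c: "palette r V c" and V: "finite V" "2 \<le> card V"
  shows "random_structure {1..r} (metric_class r) (palette_template r V c) \<longleftrightarrow> metric_palette V c"
proof
  assume R: "random_structure {1..r} (metric_class r) (palette_template r V c)"
  show "metric_palette V c"
    unfolding metric_palette_def
  proof (intro ballI impI)
    fix x y z i j k
    assume xyz: "x \<in> V" "y \<in> V" "z \<in> V" "x \<noteq> y" "y \<noteq> z" "x \<noteq> z"
      and ijk: "i \<in> c {x, z}" "j \<in> c {x, y}" "k \<in> c {y, z}"
    \<comment> \<open>Distances in different pairs are chosen independently, so the three given ones extend to a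
        choice on all pairs, which randomness turns into a metric.\<close>
    define d where "d = (\<lambda>A. SOME i. i \<in> c A)({x, z} := i, {x, y} := j, {y, z} := k)"
    have "(SOME i. i \<in> c A) \<in> c A" if "A \<in> pairs V" for A
      using c that by (auto simp: palette_def some_in_eq)
    then have d: "d A \<in> c A" if "A \<in> pairs V" for A
      using that ijk by (auto simp: d_def)
    let ?\<xi> = "\<lambda>A. dist_diag r (d A) A"
    have "choice_function {1..r} (metric_class r) (palette_template r V c) ?\<xi>"
      unfolding choice_function_palette_template[OF c] using d by (intro exI[of _ d]) simp
    then obtain N where N: "N \<in> metric_class r"
      "full_subpattern_by {1..r} (metric_class r) ?\<xi> N (palette_template r V c)"
      using R by (auto simp: random_structure_def)
    have "full_subpattern_by {1..r} (metric_class r) ?\<xi> N (palette_template r V c) \<longleftrightarrow>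
        N = dist_structure r V d"
      by (rule full_subpattern_by_palette_template[OF c V(2)]) (use d in auto)
    with N(2) have N': "N = dist_structure r V d" by simp
    obtain W e where W: "metric_on r W e" "N = dist_structure r W e"
      using metric_class_imp_dist_structure[OF N(1)] by metis
    have "W = V" using N' W(2) by (metis univ_dist_structure)
    have "e A = d A" if "A \<in> pairs V" for A
    proof (rule dist_diag_inj[of r _ A])
      show "dist_diag r (e A) A = dist_diag r (d A) A" "card A = 2"
        using that N' W(2) \<open>W = V\<close> diag_dist_structure[of A V r d] diag_dist_structure[of A V r e]
        by (auto simp: pairs_def)
      show "e A \<in> {1..r}" using W(1) that \<open>W = V\<close> by (auto simp: metric_on_def)
    qed
    then have "d {x, z} \<le> d {x, y} + d {y, z}"
      using W(1) xyz unfolding metric_on_def \<open>W = V\<close> by (metis pairsI)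
    then show "i \<le> j + k" using xyz by (auto simp: d_def doubleton_eq_iff)
  qed
next
  assume m: "metric_palette V c"
  have "complete_structure {1..r} (metric_class r) (palette_template r V c)"
    using template_palette_template[OF c V(2)] by (simp add: template_def)
  moreover have "\<exists>N\<in>metric_class r. full_subpattern_by {1..r} (metric_class r) \<xi> N (palette_template r V c)"
    if \<xi>: "choice_function {1..r} (metric_class r) (palette_template r V c) \<xi>" for \<xi>
  proof -
    obtain d where "\<forall>A\<in>pairs V. d A \<in> c A \<and> \<xi> A = dist_diag r (d A) A"
      using \<xi> unfolding choice_function_palette_template[OF c] by (elim exE)
    then have d: "\<And>A. A \<in> pairs V \<Longrightarrow> d A \<in> c A" "\<And>A. A \<in> pairs V \<Longrightarrow> \<xi> A = dist_diag r (d A) A"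
      by auto
    have "metric_on r V d"
      unfolding metric_on_def
    proof (intro conjI ballI impI)
      show "d A \<in> {1..r}" if "A \<in> pairs V" for A using palette_mem[OF c that d(1)[OF that]] .
      show "d {x, z} \<le> d {x, y} + d {y, z}"
        if "x \<in> V" "y \<in> V" "z \<in> V" "x \<noteq> y" "y \<noteq> z" "x \<noteq> z" for x y z
        using m d(1) that by (simp add: metric_palette_def pairsI)
    qed
    then have "dist_structure r V d \<in> metric_class r"
      by (rule dist_structure_in_metric_class[OF V(1)])
    moreover have "full_subpattern_by {1..r} (metric_class r) \<xi> (dist_structure r V d) (palette_template r V c)"
      by (subst full_subpattern_by_palette_template[OF c V(2) d]) auto
    ultimately show ?thesis by blast
  qed
  ultimately show "random_structure {1..r} (metric_class r) (palette_template r V c)"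
    by (simp add: random_structure_def)
qed

text \<open>
  Types in templates at a pair depend only on the set of distances allowed there.
\<close>

lemma delta_close_palette_template:
  fixes V :: "'v set"
  assumes "finite V" "real (card {A \<in> pairs V. c A \<noteq> c' A}) \<le> \<delta> * real (card V choose 2)"
  shows "delta_close {1..r} (metric_class r) \<delta> (palette_template r V c) (palette_template r V c')"
proof -
  let ?S = "S2 {1..r} (metric_class r :: (nat, 'v) rstruct set)"
  let ?M = "palette_template r V c" and ?M' = "palette_template r V c'"
  have "qftp ?S ?M a b = qftp ?S ?M' a b" if "c {a, b} = c' {a, b}" for a b
  proof -
    have "sat ?M (tup a b) \<phi> \<longleftrightarrow> sat ?M' (tup a b) \<phi>" if "\<phi> \<in> formulas ?S {1, 2}" for \<phi>
      using that \<open>c {a, b} = c' {a, b}\<close>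
      by (intro sat_cong) (auto simp: rel_palette_template insert_commute)
    then show ?thesis by (auto simp: qftp_def)
  qed
  then have "{A \<in> pairs V. \<exists>a b. {a, b} = A \<and> qftp ?S ?M a b \<noteq> qftp ?S ?M' a b}
      \<subseteq> {A \<in> pairs V. c A \<noteq> c' A}" by blast
  from card_mono[OF _ this] assms show ?thesis
    by (simp add: delta_close_def finite_pairs)
qed


section \<open>Averaging over triangles\<close>

text \<open>
  Double counting: each pair lies in exactly \<open>card V - 2\<close> triangles, so the sum over all triangles
  is that multiple of the sum over all pairs.
\<close>

lemma sum_pairs_nonneg:
  fixes g :: "'v set \<Rightarrow> real"
  assumes "finite V" "3 \<le> card V"
    and g: "\<And>x y z. x \<in> V \<Longrightarrow> y \<in> V \<Longrightarrow> z \<in> V \<Longrightarrow> x \<noteq> y \<Longrightarrow> y \<noteq> z \<Longrightarrow> x \<noteq> z \<Longrightarrow>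
      0 \<le> g {x, y} + g {y, z} + g {x, z}"
  shows "0 \<le> (\<Sum>A\<in>pairs V. g A)"
proof -
  define T where "T = {S. S \<subseteq> V \<and> card S = 3}"
  have T: "finite T" unfolding T_def
    by (rule finite_subset[of _ "Pow V"]) (use assms(1) in auto)
  have "0 \<le> (\<Sum>S\<in>T. \<Sum>A\<in>{A \<in> pairs V. A \<subseteq> S}. g A)"
  proof (rule sum_nonneg)
    fix S assume "S \<in> T"
    then obtain x y z where S: "S = {x, y, z}" "x \<noteq> y" "y \<noteq> z" "x \<noteq> z" "S \<subseteq> V"
      by (auto simp: T_def card_3_iff)
    have "{A \<in> pairs V. A \<subseteq> S} = {{x, y}, {y, z}, {x, z}}"
    proof (intro equalityI subsetI)
      fix A assume "A \<in> {A \<in> pairs V. A \<subseteq> S}"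
      then obtain u v where "A = {u, v}" "u \<noteq> v" "u \<in> S" "v \<in> S" by (auto elim: pairsE)
      then show "A \<in> {{x, y}, {y, z}, {x, z}}" using S by auto
    qed (use S in \<open>auto intro: pairsI\<close>)
    moreover have "{x, y} \<noteq> {y, z}" "{x, y} \<noteq> {x, z}" "{y, z} \<noteq> {x, z}"
      using S by (auto simp: doubleton_eq_iff)
    ultimately have "(\<Sum>A\<in>{A \<in> pairs V. A \<subseteq> S}. g A) = g {x, y} + g {y, z} + g {x, z}"
      by simp
    then show "0 \<le> (\<Sum>A\<in>{A \<in> pairs V. A \<subseteq> S}. g A)" using g S by simp
  qed
  also have "\<dots> = (\<Sum>A\<in>pairs V. \<Sum>S\<in>{S \<in> T. A \<subseteq> S}. g A)"
    by (rule sum.swap_restrict) (use T assms(1) finite_pairs in auto)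
  also have "\<dots> = (\<Sum>A\<in>pairs V. real (card V - 2) * g A)"
  proof (rule sum.cong)
    fix A assume "A \<in> pairs V"
    then have A: "A \<subseteq> V" "card A = 2" "finite A" by (auto simp: pairs_def card_2_iff)
    have "{S \<in> T. A \<subseteq> S} = (\<lambda>z. insert z A) ` (V - A)"
    proof (intro equalityI subsetI)
      fix S assume S: "S \<in> {S \<in> T. A \<subseteq> S}"
      then have "card (S - A) = 1" using A by (simp add: T_def card_Diff_subset)
      then obtain z where "S - A = {z}" by (rule card_1_singletonE)
      then have "z \<in> V - A" "S = insert z A" using S by (auto simp: T_def)
      then show "S \<in> (\<lambda>z. insert z A) ` (V - A)" by blast
    qed (use A in \<open>auto simp: T_def\<close>)
    moreover have "inj_on (\<lambda>z. insert z A) (V - A)" by (rule inj_onI) blast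
    ultimately have "card {S \<in> T. A \<subseteq> S} = card V - 2"
      using A by (simp add: card_image card_Diff_subset)
    then show "(\<Sum>S\<in>{S \<in> T. A \<subseteq> S}. g A) = real (card V - 2) * g A" by simp
  qed simp
  also have "\<dots> = real (card V - 2) * (\<Sum>A\<in>pairs V. g A)" by (simp add: sum_distrib_left)
  finally show ?thesis using assms(2) by (simp add: zero_le_mult_iff)
qed

lemma card_pairs: "finite V \<Longrightarrow> card (pairs V) = card V choose 2"
  by (simp add: pairs_def n_subsets)

lemma card_add_Min_le:
  assumes "A \<noteq> {}" "finite (A :: nat set)"
  shows "card A + Min A \<le> Max A + 1"
proof -
  have "A \<subseteq> {Min A..Max A}" using assms by auto
  from card_mono[OF _ this] have "card A \<le> Max A + 1 - Min A" by simp
  moreover have "Min A \<le> Max A" using Min_le[OF assms(2) Max_in[OF assms(2,1)]] .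
  ultimately show ?thesis by simp
qed

definition triangle_sets :: "nat set \<Rightarrow> nat set \<Rightarrow> nat set \<Rightarrow> bool" where
  "triangle_sets A B C \<longleftrightarrow> (\<forall>a\<in>A. \<forall>b\<in>B. \<forall>c\<in>C. a \<le> b + c \<and> b \<le> a + c \<and> c \<le> a + b)"

text \<open>
  Adding the three bounds on the sizes to the inequalities between maxima and minima cancels the
  minima. If all sizes are \<open>h + 1\<close>, every inequality used is tight, which forces all minima to be
  at least \<open>h\<close>.
\<close>

lemma triangle_sets_card_sum:
  assumes "triangle_sets A B C" and ne: "A \<noteq> {}" "B \<noteq> {}" "C \<noteq> {}"
    and sub: "A \<subseteq> {1..2*h}" "B \<subseteq> {1..2*h}" "C \<subseteq> {1..2*h}"
  shows "card A + card B + card C \<le> 3 * (h + 1)"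
    and "card A = h + 1 \<Longrightarrow> card B = h + 1 \<Longrightarrow> card C = h + 1 \<Longrightarrow>
      A = {h..2*h} \<and> B = {h..2*h} \<and> C = {h..2*h}"
proof -
  have fin: "finite A" "finite B" "finite C" using sub finite_subset by blast+
  note card = card_add_Min_le[OF ne(1) fin(1)] card_add_Min_le[OF ne(2) fin(2)] card_add_Min_le[OF ne(3) fin(3)]
  have Max: "Max A \<in> A" "Max B \<in> B" "Max C \<in> C" and Min: "Min A \<in> A" "Min B \<in> B" "Min C \<in> C"
    using ne fin by auto
  have tri: "Max A \<le> Min B + Min C" "Max B \<le> Min A + Min C" "Max C \<le> Min A + Min B"
    using assms(1) Max Min unfolding triangle_sets_def by blast+
  have le: "Max A \<le> 2*h" "Max B \<le> 2*h" "Max C \<le> 2*h" using Max sub by auto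
  have "Max A + Max B + Max C \<le> 2 * (Min A + Min B + Min C)" using tri by simp
  then show "card A + card B + card C \<le> 3 * (h + 1)" using card le by simp
  assume full: "card A = h + 1" "card B = h + 1" "card C = h + 1"
  have "Min A \<ge> h \<and> Min B \<ge> h \<and> Min C \<ge> h"
    using card tri le full by linarith
  moreover have "X \<subseteq> {h..2*h}" if "finite X" "X \<subseteq> {1..2*h}" "h \<le> Min X" for X
  proof
    fix x assume "x \<in> X"
    then show "x \<in> {h..2*h}" using Min_le[OF that(1), of x] that(2,3) by auto
  qed
  ultimately have "A \<subseteq> {h..2*h}" "B \<subseteq> {h..2*h}" "C \<subseteq> {h..2*h}"
    using fin sub by simp_all
  then show "A = {h..2*h} \<and> B = {h..2*h} \<and> C = {h..2*h}"
    using full by (intro conjI card_subset_eq) simp_all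
qed

text \<open>
  The least drop of \<open>ln (a b c)\<close> below \<open>ln (m\<^sup>3)\<close> for integers with \<open>a b c < m\<^sup>3\<close>.
\<close>

definition gap :: "nat \<Rightarrow> real" where
  "gap m = ln (real m ^ 3) - ln (real m ^ 3 - 1)"

lemma gap_pos: "2 \<le> m \<Longrightarrow> 0 < gap m"
proof -
  assume "2 \<le> m"
  then have "(2::real) ^ 3 \<le> real m ^ 3" by (intro power_mono) auto
  then show ?thesis
    unfolding gap_def diff_gt_0_iff_gt using \<open>2 \<le> m\<close> by (subst ln_less_cancel_iff) simp_all
qed

text \<open>
  The inequality of arithmetic and geometric means, from \<open>ln t \<le> t - 1\<close> at \<open>t = a/m, b/m, c/m\<close>;
  equality holds there only for \<open>t = 1\<close>. Otherwise \<open>a b c < m\<^sup>3\<close>, and integrality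
  improves this to \<open>a b c \<le> m\<^sup>3 - 1\<close>.
\<close>

lemma ln_sum_three:
  fixes a b c m :: nat
  assumes pos: "0 < a" "0 < b" "0 < c" "0 < m" and sum: "a + b + c \<le> 3 * m"
  shows "ln a + ln b + ln c \<le> 3 * ln m"
    and "\<not> (a = m \<and> b = m \<and> c = m) \<Longrightarrow> ln a + ln b + ln c \<le> 3 * ln m - gap m"
proof -
  have le: "ln (real x) \<le> ln m + (x / m - 1)" if "0 < x" for x :: nat
    using ln_le_minus_one[of "x / m"] that pos by (simp add: ln_div)
  have eq: "x = m" if "0 < x" "ln (real x) = ln m + (x / m - 1)" for x :: nat
    using ln_eq_minus_one[of "x / m"] that pos by (simp add: ln_div)
  have s: "a / m + b / m + c / m \<le> (3::real)"
    using sum pos by (simp add: add_divide_distrib[symmetric] divide_le_eq)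
  note les = le[OF pos(1)] le[OF pos(2)] le[OF pos(3)]
  show sum_le: "ln a + ln b + ln c \<le> 3 * ln m" using les s by linarith
  assume ne: "\<not> (a = m \<and> b = m \<and> c = m)"
  have "ln a + ln b + ln c \<noteq> 3 * ln m"
  proof
    assume "ln a + ln b + ln c = 3 * ln m"
    then have "ln (real a) = ln m + (a / m - 1)" "ln (real b) = ln m + (b / m - 1)"
      "ln (real c) = ln m + (c / m - 1)" using les s by linarith+
    then show False using eq pos ne by blast
  qed
  then have "ln (real (a * b * c)) < ln (real (m ^ 3))"
    using sum_le pos by (simp add: ln_mult ln_realpow)
  then have "a * b * c < m ^ 3"
    using pos by (subst (asm) ln_less_cancel_iff) (simp_all only: of_nat_0_less_iff of_nat_less_iff, simp_all)
  then have "a * b * c + 1 \<le> m ^ 3" by simp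
  then have "real (a * b * c + 1) \<le> real (m ^ 3)" by (simp only: of_nat_le_iff)
  then have "real (a * b * c) \<le> real m ^ 3 - 1" by simp
  then have "ln (real (a * b * c)) \<le> ln (real m ^ 3 - 1)"
    using pos by (intro ln_mono) auto
  then show "ln a + ln b + ln c \<le> 3 * ln m - gap m"
    using pos by (simp add: gap_def ln_mult ln_realpow)
qed

text \<open>
  The key estimate. A triangle containing a pair whose set is not \<open>{h..2h}\<close> has logarithmic
  deficit at least \<open>gap (h + 1)\<close>, and this pays \<open>gap (h + 1) / 3\<close> for each of its at most three
  such pairs. So deficit minus charge has a nonnegative sum over every triangle, hence over all
  pairs.
\<close>

lemma sum_ln_card_palette_le:
  assumes c: "palette (2 * h) V c" and m: "metric_palette V c" and V: "finite V" "3 \<le> card V" and h: "1 \<le> h"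
  shows "(\<Sum>A\<in>pairs V. ln (card (c A))) \<le>
    real (card V choose 2) * ln (real (h + 1)) - gap (h + 1) / 3 * real (card {A \<in> pairs V. c A \<noteq> {h..2*h}})"
proof -
  define b where "b A = (if c A \<noteq> {h..2*h} then gap (h + 1) / 3 else 0)" for A
  have gap: "0 < gap (h + 1)" using h by (intro gap_pos) simp
  have "0 \<le> (\<Sum>A\<in>pairs V. ln (real (h + 1)) - ln (card (c A)) - b A)"
  proof (rule sum_pairs_nonneg[OF V])
    fix x y z assume xyz: "x \<in> V" "y \<in> V" "z \<in> V" "x \<noteq> y" "y \<noteq> z" "x \<noteq> z"
    let ?A = "c {x, y}" and ?B = "c {y, z}" and ?C = "c {x, z}"
    have ne: "?A \<noteq> {}" "?B \<noteq> {}" "?C \<noteq> {}"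
      and sub: "?A \<subseteq> {1..2*h}" "?B \<subseteq> {1..2*h}" "?C \<subseteq> {1..2*h}"
      using c xyz by (auto simp: palette_def dest: pairsI)
    have pos: "0 < card ?A" "0 < card ?B" "0 < card ?C"
      using palette_card_pos[OF c] xyz by (simp_all add: pairsI)
    have tri: "triangle_sets ?A ?B ?C"
      unfolding triangle_sets_def
    proof (intro ballI conjI)
      fix i j k assume "i \<in> ?A" "j \<in> ?B" "k \<in> ?C"
      moreover have "i \<in> c {y, x}" "j \<in> c {z, y}" "k \<in> c {z, x}"
        using calculation by (simp_all add: insert_commute)
      moreover have "i' \<le> j' + k'"
        if "x' \<in> V" "y' \<in> V" "z' \<in> V" "x' \<noteq> y'" "y' \<noteq> z'" "x' \<noteq> z'"
          "i' \<in> c {x', z'}" "j' \<in> c {x', y'}" "k' \<in> c {y', z'}" for x' y' z' i' j' k'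
        using m that unfolding metric_palette_def by blast
      ultimately show "i \<le> j + k" "j \<le> i + k" "k \<le> i + j"
        using xyz by (metis add.commute)+
    qed
    note sum = triangle_sets_card_sum[OF tri ne sub]
    show "0 \<le> (ln (real (h + 1)) - ln (card ?A) - b {x, y}) + (ln (real (h + 1)) - ln (card ?B) - b {y, z})
        + (ln (real (h + 1)) - ln (card ?C) - b {x, z})"
    proof (cases "card ?A = h + 1 \<and> card ?B = h + 1 \<and> card ?C = h + 1")
      case True
      then show ?thesis using sum(2) by (simp add: b_def)
    next
      case False
      have "ln (card ?A) + ln (card ?B) + ln (card ?C) \<le> 3 * ln (real (h + 1)) - gap (h + 1)"
        by (rule ln_sum_three(2)[OF pos _ sum(1) False]) simp
      moreover have "b A \<le> gap (h + 1) / 3" for A using gap by (simp add: b_def)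
      from this[of "{x, y}"] this[of "{y, z}"] this[of "{x, z}"]
      have "b {x, y} + b {y, z} + b {x, z} \<le> gap (h + 1)" by simp
      ultimately show ?thesis by linarith
    qed
  qed
  also have "\<dots> = real (card V choose 2) * ln (real (h + 1)) - (\<Sum>A\<in>pairs V. ln (card (c A))) - (\<Sum>A\<in>pairs V. b A)"
    using V by (simp add: sum_subtractf card_pairs)
  also have "(\<Sum>A\<in>pairs V. b A) = gap (h + 1) / 3 * real (card {A \<in> pairs V. c A \<noteq> {h..2*h}})"
    unfolding b_def using V by (simp add: sum.If_cases finite_pairs Int_def)
  finally show ?thesis by linarith
qed


section \<open>Extremal templates and stability\<close>

lemma random_templatesE:
  fixes M :: "(nat, 'v) pstruct"
  assumes "M \<in> random_templates {1..r} (metric_class r) n" "2 \<le> n"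
  obtains V c where "finite V" "card V = n" "palette r V c" "metric_palette V c"
    "M = palette_template r V c"
proof -
  have M: "template {1..r} (metric_class r) M" "random_structure {1..r} (metric_class r) M"
    "finite (univ M)" "card (univ M) = n"
    using assms by (auto simp: random_templates_def)
  obtain c where c: "palette r (univ M) c" "M = palette_template r (univ M) c"
    using template_imp_palette_template[OF M(1)] M(4) assms(2) by auto
  moreover have "metric_palette (univ M) c"
    using random_palette_template_iff[OF c(1) M(3)] M(2,4) c(2) assms(2) by simp
  ultimately show ?thesis using that M by blast
qed

lemma ln_sub_palette_template:
  fixes V :: "'v set"
  assumes c: "palette r V c" and V: "finite V" "2 \<le> card V"
  shows "0 < sub {1..r} (metric_class r) (palette_template r V c)"
    and "ln (sub {1..r} (metric_class r) (palette_template r V c)) = (\<Sum>A\<in>pairs V. ln (card (c A)))"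
proof -
  note pos = palette_card_pos[OF c]
  show "0 < sub {1..r} (metric_class r) (palette_template r V c)"
    using pos by (simp add: sub_palette_template[OF assms] prod_pos)
  show "ln (sub {1..r} (metric_class r) (palette_template r V c)) = (\<Sum>A\<in>pairs V. ln (card (c A)))"
    using pos V by (simp add: sub_palette_template[OF assms] ln_prod finite_pairs)
qed

lemma uniform_palette_template:
  fixes V :: "'v set"
  assumes h: "1 \<le> h" and V: "finite V" "2 \<le> card V"
  shows "palette_template (2*h) V (\<lambda>_. {h..2*h}) \<in> random_templates {1..2*h} (metric_class (2*h)) (card V)"
    and "sub {1..2*h} (metric_class (2*h)) (palette_template (2*h) V (\<lambda>_. {h..2*h})) = (h + 1) ^ (card V choose 2)"
proof -
  have c: "palette (2*h) V (\<lambda>_. {h..2*h})" using h by (auto simp: palette_def)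
  have "metric_palette V (\<lambda>_. {h..2*h})" by (auto simp: metric_palette_def)
  then show "palette_template (2*h) V (\<lambda>_. {h..2*h}) \<in> random_templates {1..2*h} (metric_class (2*h)) (card V)"
    using random_palette_template_iff[OF c V] template_palette_template[OF c V(2)] V
    by (simp add: random_templates_def)
  show "sub {1..2*h} (metric_class (2*h)) (palette_template (2*h) V (\<lambda>_. {h..2*h})) = (h + 1) ^ (card V choose 2)"
    using V by (simp add: sub_palette_template[OF c V] card_pairs Suc_eq_plus1)
qed

text \<open>
  That \<open>V\<close> exists means that the type of points has enough elements for templates of this size to
  exist. All their values of \<open>sub\<close> are bounded by the one of the constant palette, so the maximum
  is over a finite set.
\<close>

lemma ex_num_metric_class:
  fixes V :: "'v set"
  assumes h: "1 \<le> h" and V: "finite V" "3 \<le> card V"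
  shows "ex_num {1..2*h} (metric_class (2*h) :: (nat, 'v) rstruct set) (card V) = (h + 1) ^ (card V choose 2)"
proof -
  let ?P = "metric_class (2*h) :: (nat, 'v) rstruct set"
  have two_le: "2 \<le> card V" using V(2) by simp
  have le: "sub {1..2*h} ?P M \<le> (h + 1) ^ (card V choose 2)"
    if M: "M \<in> random_templates {1..2*h} ?P (card V)" for M
  proof -
    obtain W c where W: "finite W" "card W = card V" "palette (2*h) W c" "metric_palette W c"
      and eq: "M = palette_template (2*h) W c"
      using two_le by (rule random_templatesE[OF M])
    have pos: "0 < sub {1..2*h} ?P M"
      using ln_sub_palette_template(1)[OF W(3,1)] W(2) V by (simp add: eq)
    have "0 < gap (h + 1)" using h by (intro gap_pos) simp
    then have "0 \<le> gap (h + 1) / 3 * real (card {A \<in> pairs W. c A \<noteq> {h..2*h}})" by simp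
    moreover have "ln (sub {1..2*h} ?P M) = (\<Sum>A\<in>pairs W. ln (card (c A)))"
      using ln_sub_palette_template(2)[OF W(3,1)] W(2) V by (simp add: eq)
    ultimately have "ln (sub {1..2*h} ?P M) \<le> real (card V choose 2) * ln (real (h + 1))"
      using sum_ln_card_palette_le[OF W(3,4,1) _ h] W(2) V by simp
    also have "\<dots> = ln (real ((h + 1) ^ (card V choose 2)))"
      by (simp add: ln_realpow)
    finally show ?thesis
      using pos by (subst (asm) ln_le_cancel_iff) (simp_all only: of_nat_le_iff of_nat_0_less_iff, simp_all)
  qed
  show ?thesis
    unfolding ex_num_def
  proof (rule Max_eqI)
    show "finite (sub {1..2*h} ?P ` random_templates {1..2*h} ?P (card V))"
      by (rule finite_subset[of _ "{..(h + 1) ^ (card V choose 2)}"]) (use le in auto)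
    show "(h + 1) ^ (card V choose 2) \<in> sub {1..2*h} ?P ` random_templates {1..2*h} ?P (card V)"
      using image_eqI[of _ "sub {1..2*h} ?P", OF uniform_palette_template(2)[OF h V(1) two_le, symmetric]
          uniform_palette_template(1)[OF h V(1) two_le]] .
  qed (use le in auto)
qed

theorem theorem15:
  fixes r :: nat
  assumes "r \<ge> 2" and "even r"
  shows "has_stability_theorem {1..r} (metric_class r :: (nat, 'v) rstruct set)"
proof -
  obtain h where r: "r = 2 * h" using assms(2) by (rule evenE)
  have h: "1 \<le> h" using assms(1) r by simp
  let ?P = "metric_class r :: (nat, 'v) rstruct set"
  let ?\<kappa> = "gap (h + 1)" and ?l = "ln (real (h + 1))"
  have \<kappa>: "0 < ?\<kappa>" using h by (intro gap_pos) simp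
  have l: "0 < ?l" using h by simp
  show ?thesis
    unfolding has_stability_theorem_def
  proof (intro allI impI)
    fix \<delta> :: real assume \<delta>: "0 < \<delta>"
    \<comment> \<open>Chosen so that a loss of \<open>\<epsilon> ln (h + 1)\<close> per pair pays for at most a proportion \<open>\<delta>\<close> of pairs,
        each of which costs \<open>\<kappa>/3\<close>.\<close>
    define \<epsilon> where "\<epsilon> = \<delta> * ?\<kappa> / (3 * ?l)"
    have "\<exists>M'\<in>extremal_templates {1..r} ?P n. delta_close {1..r} ?P \<delta> M M'"
      if n: "2 < n" and M: "M \<in> random_templates {1..r} ?P n"
        and large: "real (ex_num {1..r} ?P n) powr (1 - \<epsilon>) \<le> real (sub {1..r} ?P M)" for n M
    proof -
      have two_le: "2 \<le> n" using n by simp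
      obtain V c where V: "finite V" "card V = n" and c: "palette r V c" "metric_palette V c"
        and eq: "M = palette_template r V c"
        using two_le by (rule random_templatesE[OF M])
      let ?M' = "palette_template r V (\<lambda>_. {h..2*h})"
      let ?B = "{A \<in> pairs V. c A \<noteq> {h..2*h}}"
      have ex: "ex_num {1..r} ?P n = (h + 1) ^ (n choose 2)"
        using ex_num_metric_class[OF h V(1)] V(2) n r by simp
      then have "?M' \<in> extremal_templates {1..r} ?P n"
        using uniform_palette_template[OF h V(1)] V(2) n r by (simp add: extremal_templates_def)
      moreover have "real (card ?B) \<le> \<delta> * real (n choose 2)"
      proof -
        have "(1 - \<epsilon>) * (real (n choose 2) * ?l) = ln (real (ex_num {1..r} ?P n) powr (1 - \<epsilon>))"
          by (simp add: ex ln_powr ln_realpow)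
        also have "\<dots> \<le> ln (real (sub {1..r} ?P M))"
          using large by (intro ln_mono) (auto simp: ex)
        also have "\<dots> = (\<Sum>A\<in>pairs V. ln (card (c A)))"
          using ln_sub_palette_template(2)[OF c(1) V(1)] V(2) n by (simp add: eq)
        also have "\<dots> \<le> real (n choose 2) * ?l - ?\<kappa> / 3 * real (card ?B)"
          using sum_ln_card_palette_le[of h V c] c V n h r by simp
        finally have "?\<kappa> / 3 * real (card ?B) \<le> (\<epsilon> * ?l) * real (n choose 2)"
          by (simp add: algebra_simps)
        also have "\<epsilon> * ?l = ?\<kappa> / 3 * \<delta>" using l by (simp add: \<epsilon>_def)
        finally show ?thesis using \<kappa> by simp
      qed
      ultimately show ?thesis
        using delta_close_palette_template[OF V(1), of c "\<lambda>_. {h..2*h}" \<delta> r] V(2) eq by auto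
    qed
    moreover have "0 < \<epsilon>" using \<delta> \<kappa> l by (simp add: \<epsilon>_def)
    ultimately show "\<exists>\<epsilon>>0. \<exists>N. \<forall>n>N. \<forall>M\<in>random_templates {1..r} ?P n.
        real (ex_num {1..r} ?P n) powr (1 - \<epsilon>) \<le> real (sub {1..r} ?P M) \<longrightarrow>
        (\<exists>M'\<in>extremal_templates {1..r} ?P n. delta_close {1..r} ?P \<delta> M M')"
      by blast
  qed
qed

end
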